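(* CPA implies that $\mathbb{R}$ can be covered by less than continuum many translates of $C_0$, where $C_0 = \left\{\sum_{n=2}^{\infty} \frac{d_n}{n!} : d_n \in\{0,1,\dots,n-2\} \text{ for all } n \right\}\subset\mathbb{R}$. That is, under CPA there exists a set $A\subset\mathbb{R}$ with $|A|<2^{\omega}$ and $\bigcup_{a\in A}(C_0+a)=\mathbb{R}$.
   Context: CPA is the well known axiom of Ciesielski and Pawlikowski (the Covering Property Axiom). For $a\in\mathbb{R}$, the translate $C_0+a$ is $\{c+a : c\in C_0\}$. "Continuum" means the cardinal $2^{\omega}$. *)

theory Defs
  imports "HOL-Analysis.Analysis"
begin

unbundle cardinal_syntax

definition C0 :: "real set" where
  "C0 = {x. \<exists>d :: nat \<Rightarrow> nat. (\<forall>n\<ge>2. d n \<in> {0..n - 2}) \<and>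
              x = (\<Sum>n. real (d (n + 2)) / fact (n + 2))}"

definition translate :: "real set \<Rightarrow> real \<Rightarrow> real set" where
  "translate S a = {c + a | c. c \<in> S}"

abbreviation continuum :: "(nat \<Rightarrow> bool) rel" where
  "continuum \<equiv> |UNIV :: (nat \<Rightarrow> bool) set|"

abbreviation omega1 :: "nat set rel" where
  "omega1 \<equiv> cardSuc natLeq"

abbreviation omega2 :: "nat set set rel" where
  "omega2 \<equiv> cardSuc omega1"

text \<open>The Cantor set is \<open>2\<^sup>\<omega>\<close> with the product topology, i.e. the type \<open>nat \<Rightarrow> bool\<close> with its
  type class topology (\<open>bool\<close> is discrete, function spaces carry the product topology); likewise
  its countable power is \<open>nat \<Rightarrow> nat \<Rightarrow> bool\<close>.\<close>

type_synonym cantor = "nat \<Rightarrow> bool"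

definition Polish :: "'a topology \<Rightarrow> bool" where
  "Polish X \<longleftrightarrow> completely_metrizable_space X \<and> separable_space X"

definition Perf :: "'a topology \<Rightarrow> 'a set set" where
  "Perf X = {P. P \<subseteq> topspace X \<and>
                subtopology X P homeomorphic_space (euclidean :: cantor topology)}"

definition perfect_cube :: "(nat \<Rightarrow> cantor) set \<Rightarrow> bool" where
  "perfect_cube D \<longleftrightarrow> (\<exists>P. (\<forall>n. P n \<in> Perf euclidean) \<and> D = {x. \<forall>n. x n \<in> P n})"

text \<open>The continuous injections from perfect cubes into \<open>X\<close>. A partial function is represented by a
  pair of its domain and a total function, whose values off the domain are irrelevant.\<close>

definition F_cube :: "'a topology \<Rightarrow> ((nat \<Rightarrow> cantor) set \<times> ((nat \<Rightarrow> cantor) \<Rightarrow> 'a)) set" where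
  "F_cube X = {(D, f). perfect_cube D \<and> inj_on f D \<and>
                       continuous_map (subtopology euclidean D) X f}"

text \<open>\<open>E\<close> is \<open>F_cube\<close>-dense if every \<open>f\<close> in \<open>F_cube\<close> has a restriction \<open>g\<close> in \<open>F_cube\<close> whose range
  belongs to \<open>E\<close>.\<close>

definition F_cube_dense :: "'a topology \<Rightarrow> 'a set set \<Rightarrow> bool" where
  "F_cube_dense X E \<longleftrightarrow>
     E \<subseteq> Perf X \<and> (\<forall>(D, f)\<in>F_cube X. \<exists>D'\<subseteq>D. (D', f) \<in> F_cube X \<and> f ` D' \<in> E)"

text \<open>The Covering Property Axiom of Ciesielski and Pawlikowski, in its basic form \<open>CPA_cube\<close>. The
  axiom is stated in the literature in several forms of increasing strength (for cubes, for prisms,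
  and game versions of both); every one of them implies \<open>CPA_cube\<close>, so that a consequence of
  \<open>CPA_cube\<close> is a consequence of the axiom in all of its forms.

  A Polish space has at most continuum many points, hence is homeomorphic to one whose underlying
  set is a set of reals. So letting \<open>X\<close> range over all topologies on sets of reals (not just over
  subspaces of the real line) covers all Polish spaces.\<close>

definition CPA_cube :: bool where
  "CPA_cube \<longleftrightarrow>
     continuum =o omega2 \<and>
     (\<forall>X :: real topology. Polish X \<longrightarrow>
        (\<forall>E. F_cube_dense X E \<longrightarrow>
           (\<exists>E0\<subseteq>E. |E0| \<le>o omega1 \<and> |topspace X - \<Union>E0| \<le>o omega1)))"

end

theory Submission
  imports Defs
begin

text \<open>
  In the factorial number system a real has digits in \<open>{0..n - 1}\<close> at the places \<open>n \<ge> 2\<close>, and \<open>C0\<close>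
  consists of the sums of digit sequences that avoid the largest digit \<open>n - 1\<close> at every place.

  Call a set \<open>K\<close> of reals thin if, for all large \<open>n\<close>, fewer than \<open>n / 2\<close> of the intervals
  \<open>[j / n!, (j + 1) / n!)\<close> meet \<open>K\<close>. For a thin set, one real \<open>a\<close> can be built digit by digit so that
  no \<open>x - a\<close> with \<open>x \<in> K\<close> has the largest digit at any large place: each interval rules out only two
  choices for the \<open>n\<close>-th digit of \<open>a\<close>, and there are \<open>n\<close> choices. The finitely many remaining digits
  of \<open>x - a\<close> change it by a rational number, so countably many translates of \<open>C0\<close> cover \<open>K\<close>
  (\<open>thin_set_covered_by_rational_translates\<close>).

  The perfect sets covered in this way are dense for cubes (\<open>ex_thin_subcube\<close>). For a
  continuous injection \<open>f\<close> on a perfect cube, the value of \<open>f\<close> up to \<open>1 / n!\<close> depends, by compactness,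
  on finitely many of the bits that code the argument. Fixing all bits to be zero
  outside a sufficiently sparse set that is still infinite in every coordinate leaves a perfect
  subcube on which so few of these finitely many bits are free that the image is thin.

  Hence \<open>CPA_cube\<close> covers the line, up to at most \<open>\<omega>\<^sub>1\<close> points, by at most \<open>\<omega>\<^sub>1\<close> such
  perfect sets. Taking countably many translates for each of them and one translate for each
  exceptional point gives \<open>\<omega>\<^sub>1\<close> translates in all, and \<open>\<omega>\<^sub>1 < \<omega>\<^sub>2 = 2\<^sup>\<omega>\<close> under the axiom.
\<close>

section \<open>Translating a thin set into \<open>C0\<close>\<close>

lemma inverse_fact_tendsto_0: "(\<lambda>n. 1 / fact n :: real) \<longlonglongrightarrow> 0"
  using summable_LIMSEQ_zero[OF summable_exp[of "1 :: real"]] by (simp add: inverse_eq_divide)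

lemma floor_scale_div_tendsto:
  fixes y :: real
  shows "(\<lambda>n. \<lfloor>fact n * y\<rfloor> / fact n) \<longlonglongrightarrow> y"
proof -
  have lim: "(\<lambda>n. y - 1 / fact n) \<longlonglongrightarrow> y - 0"
    by (intro tendsto_diff tendsto_const) (rule inverse_fact_tendsto_0)
  have "y - 1 / fact n \<le> \<lfloor>fact n * y\<rfloor> / fact n" "\<lfloor>fact n * y\<rfloor> / fact n \<le> y" for n
  proof -
    have "fact n * y - 1 \<le> real_of_int \<lfloor>fact n * y\<rfloor>" "real_of_int \<lfloor>fact n * y\<rfloor> \<le> fact n * y"
      by linarith+
    then have "(fact n * y - 1) / fact n \<le> \<lfloor>fact n * y\<rfloor> / fact n"
      "\<lfloor>fact n * y\<rfloor> / fact n \<le> (fact n * y) / fact n"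
      by (simp_all only: divide_right_mono fact_ge_zero)
    then show "y - 1 / fact n \<le> \<lfloor>fact n * y\<rfloor> / fact n" "\<lfloor>fact n * y\<rfloor> / fact n \<le> y"
      by (simp_all add: diff_divide_distrib)
  qed
  then show ?thesis
    using lim by (intro real_tendsto_sandwich[OF _ _ lim[simplified] tendsto_const]) auto
qed

lemma floor_mult_nat_eq:
  fixes z :: real and n :: nat
  assumes "n > 0"
  shows "\<lfloor>real n * z\<rfloor> = int n * \<lfloor>z\<rfloor> + \<lfloor>real n * z\<rfloor> mod int n"
proof -
  have "\<lfloor>real n * z\<rfloor> div int n = \<lfloor>z\<rfloor>"
    using floor_divide_real_eq_div[of "int n" "real n * z"] assms by simp
  then show ?thesis
    using mult_div_mod_eq[of "int n" "\<lfloor>real n * z\<rfloor>"] by simp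
qed

text \<open>The residue \<open>\<lfloor>n! y\<rfloor> mod n\<close> is the \<open>n\<close>-th digit of \<open>y\<close> in the factorial number system, and
  truncating \<open>y\<close> after its \<open>N\<close>-th digit gives \<open>\<lfloor>N! y\<rfloor> / N!\<close>; so the difference is a sum over the
  later digits, each of which is at most \<open>n - 2\<close> by assumption.\<close>

lemma diff_truncation_in_C0:
  fixes y :: real
  assumes "N \<ge> 1" and digit: "\<And>n. n > N \<Longrightarrow> \<lfloor>fact n * y\<rfloor> mod int n \<noteq> int n - 1"
  shows "y - \<lfloor>fact N * y\<rfloor> / fact N \<in> C0"
proof -
  define u where "u n = \<lfloor>fact (max n N) * y\<rfloor> / (fact (max n N) :: real)" for n
  define d where "d n = (if n > N then nat (\<lfloor>fact n * y\<rfloor> mod int n) else 0)" for n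
  have step: "u (n + 2) - u (n + 1) = real (d (n + 2)) / fact (n + 2)" for n
  proof (cases "n + 2 > N")
    case True
    let ?m = "n + 2"
    have F: "fact ?m = real ?m * fact (n + 1)" by simp
    have "\<lfloor>fact ?m * y\<rfloor> = int ?m * \<lfloor>fact (n + 1) * y\<rfloor> + \<lfloor>fact ?m * y\<rfloor> mod int ?m"
      using floor_mult_nat_eq[of ?m "fact (n + 1) * y"] unfolding F mult.assoc by simp
    then have "real_of_int \<lfloor>fact ?m * y\<rfloor>
        = real ?m * \<lfloor>fact (n + 1) * y\<rfloor> + real_of_int (\<lfloor>fact ?m * y\<rfloor> mod int ?m)"
      by (metis of_int_add of_int_mult of_int_of_nat_eq)
    moreover have "real_of_int (\<lfloor>fact ?m * y\<rfloor> mod int ?m) = real (d ?m)"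
      using True by (simp add: d_def)
    ultimately have "real_of_int \<lfloor>fact ?m * y\<rfloor> = real ?m * \<lfloor>fact (n + 1) * y\<rfloor> + real (d ?m)"
      by simp
    then have "\<lfloor>fact ?m * y\<rfloor> / fact ?m
        = real ?m * \<lfloor>fact (n + 1) * y\<rfloor> / fact ?m + real (d ?m) / fact ?m"
      by (simp only: add_divide_distrib)
    also have "real ?m * \<lfloor>fact (n + 1) * y\<rfloor> / fact ?m = \<lfloor>fact (n + 1) * y\<rfloor> / fact (n + 1)"
      unfolding F by (rule mult_divide_mult_cancel_left) simp
    finally show ?thesis
      using True by (simp add: u_def max_absorb1 del: fact_Suc)
  next
    case False
    then show ?thesis by (simp add: u_def d_def max_def)
  qed
  have "u \<longlonglongrightarrow> y"
  proof (rule Lim_transform_eventually[OF floor_scale_div_tendsto])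
    show "\<forall>\<^sub>F n in sequentially. \<lfloor>fact n * y\<rfloor> / fact n = u n"
      using eventually_ge_at_top[of N] by eventually_elim (simp add: u_def max_def)
  qed
  then have "(\<lambda>n. u (n + 1)) \<longlonglongrightarrow> y"
    by (rule LIMSEQ_ignore_initial_segment)
  then have "(\<lambda>n. real (d (n + 2)) / fact (n + 2)) sums (y - u 1)"
    using telescope_sums[of "\<lambda>n. u (n + 1)" y] step by simp
  moreover have "u 1 = \<lfloor>fact N * y\<rfloor> / fact N"
    using \<open>N \<ge> 1\<close> by (simp add: u_def max_def)
  moreover have "d n \<in> {0..n - 2}" if "n \<ge> 2" for n
  proof (cases "n > N")
    case True
    have "\<lfloor>fact n * y\<rfloor> mod int n < int n" "0 \<le> \<lfloor>fact n * y\<rfloor> mod int n" using that by simp_all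
    then have "nat (\<lfloor>fact n * y\<rfloor> mod int n) \<le> n - 2" using digit[OF True] that by linarith
    then show ?thesis by (simp add: d_def)
  qed (simp add: d_def)
  ultimately show ?thesis
    unfolding C0_def by (auto simp: sums_iff intro!: exI[of _ d])
qed

text \<open>The digit step in the construction of the shift: each element of \<open>J\<close> forbids two of the \<open>n\<close>
  residues, so the bound on \<open>J\<close> leaves one free. Here \<open>p\<close> is the integer built from the earlier
  digits, and \<open>b\<close> appends one digit to it.\<close>

lemma ex_avoiding_residue:
  fixes J :: "int set" and p :: int
  assumes "finite J" "card J * 2 < n"
  shows "\<exists>b. int n * p \<le> b \<and> b < int n * p + int n \<and>
             (\<forall>j\<in>J. (j - b) mod int n \<noteq> 0 \<and> (j + 1 - b) mod int n \<noteq> 0)"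
proof -
  define R where "R = (\<lambda>j. j mod int n) ` J \<union> (\<lambda>j. (j + 1) mod int n) ` J"
  have "card R \<le> card J + card J"
    unfolding R_def using assms(1)
    by (meson add_mono card_Un_le card_image_le order_trans)
  then have "card R < card {0..<int n}" using assms(2) by simp
  moreover have "finite R" using assms(1) by (simp add: R_def)
  ultimately have "\<not> {0..<int n} \<subseteq> R" using card_mono leD by blast
  then obtain r where r: "0 \<le> r" "r < int n" "r \<notin> R"
    by (metis atLeastLessThan_iff subsetI)
  have "(j - (int n * p + r)) mod int n \<noteq> 0" if "j mod int n \<noteq> r" for j
  proof
    assume "(j - (int n * p + r)) mod int n = 0"
    then have "j mod int n = (int n * p + r) mod int n"
      by (simp only: mod_eq_dvd_iff mod_0_imp_dvd)
    then show False using that r by simp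
  qed
  moreover have "j mod int n \<noteq> r" "(j + 1) mod int n \<noteq> r" if "j \<in> J" for j
    using r(3) that by (auto simp: R_def)
  ultimately show ?thesis
    using r by (intro exI[of _ "int n * p + r"]) simp
qed

text \<open>The assumptions say that the intervals \<open>[b n / n!, (b n + 1) / n!]\<close> are nested, and \<open>a\<close> is their
  common point. It is the real whose first digits up to place \<open>n\<close> are recorded by \<open>b n\<close>, with the
  right end point occurring if all later digits are maximal.\<close>

lemma ex_real_with_factorial_truncations:
  fixes b :: "nat \<Rightarrow> int"
  assumes "\<And>n. int (Suc n) * b n \<le> b (Suc n)"
      and "\<And>n. b (Suc n) < int (Suc n) * b n + int (Suc n)"
  shows "\<exists>a::real. \<forall>n. b n \<le> fact n * a \<and> fact n * a \<le> b n + 1"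
proof -
  define f g where "f n = real_of_int (b n) / fact n" and "g n = (real_of_int (b n) + 1) / fact n"
    for n
  have "\<exists>l. ((\<forall>n. f n \<le> l) \<and> f \<longlonglongrightarrow> l) \<and> ((\<forall>n. l \<le> g n) \<and> g \<longlonglongrightarrow> l)"
  proof (rule nested_sequence_unique; (intro allI)?)
    fix n
    have 1: "real (Suc n) * b n \<le> b (Suc n)"
      using assms(1)[of n] by (metis of_int_le_iff of_int_mult of_int_of_nat_eq)
    have "b (Suc n) + 1 \<le> int (Suc n) * (b n + 1)"
      using assms(2)[of n] by (simp add: algebra_simps)
    then have "real_of_int (b (Suc n) + 1) \<le> real_of_int (int (Suc n) * (b n + 1))"
      by (simp only: of_int_le_iff)
    then have 2: "real_of_int (b (Suc n)) + 1 \<le> real (Suc n) * (real_of_int (b n) + 1)"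
      by (simp only: of_int_mult of_int_of_nat_eq of_int_add of_int_1)
    have F: "fact (Suc n) = real (Suc n) * fact n" by simp
    have "f n = real (Suc n) * b n / fact (Suc n)"
      unfolding f_def F by (rule mult_divide_mult_cancel_left[symmetric]) simp
    then show "f n \<le> f (Suc n)"
      using 1 by (simp add: f_def divide_right_mono del: fact_Suc of_nat_Suc)
    have "g n = real (Suc n) * (real_of_int (b n) + 1) / fact (Suc n)"
      unfolding g_def F by (rule mult_divide_mult_cancel_left[symmetric]) simp
    then show "g (Suc n) \<le> g n"
      using 2 by (simp add: g_def divide_right_mono del: fact_Suc of_nat_Suc)
    show "f n \<le> g n" by (simp add: f_def g_def divide_right_mono)
  next
    have "f n - g n = - (1 / fact n)" for n
      by (simp add: f_def g_def field_simps)
    then show "(\<lambda>n. f n - g n) \<longlonglongrightarrow> 0"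
      using tendsto_minus[OF inverse_fact_tendsto_0] by simp
  qed
  then obtain a where "\<And>n. f n \<le> a" "\<And>n. a \<le> g n" by blast
  then show ?thesis
    by (intro exI[of _ a]) (simp add: f_def g_def field_simps)
qed

text \<open>A set that meets few intervals \<open>[j / n!, (j + 1) / n!)\<close> at every level \<open>n > N\<close> can be moved off
  the digit \<open>n - 1\<close> at all these levels by one and the same shift \<open>a\<close>. Each level forbids at most two
  residues per interval, since subtracting \<open>a\<close> may or may not cause a borrow from the later digits.
  The digits up to level \<open>N\<close> are uncontrolled, but they only contribute a rational number.\<close>

lemma thin_set_covered_by_rational_translates:
  fixes K :: "real set"
  assumes "N \<ge> 1"
      and fin: "\<And>n. n > N \<Longrightarrow> finite ((\<lambda>x. \<lfloor>fact n * x\<rfloor>) ` K)"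
      and few: "\<And>n. n > N \<Longrightarrow> card ((\<lambda>x. \<lfloor>fact n * x\<rfloor>) ` K) * 2 < n"
  shows "\<exists>a. K \<subseteq> (\<Union>q\<in>\<rat>. translate C0 (a + q))"
proof -
  define J where "J n = (\<lambda>x. \<lfloor>fact n * x\<rfloor>) ` K" for n
  define good where "good n p b \<longleftrightarrow> int n * p \<le> b \<and> b < int n * p + int n \<and>
      (n > N \<longrightarrow> (\<forall>j\<in>J n. (j - b) mod int n \<noteq> 0 \<and> (j + 1 - b) mod int n \<noteq> 0))" for n p b
  have "\<exists>b. good (Suc n) p b" for n p
  proof (cases "Suc n > N")
    case True
    then show ?thesis
      using ex_avoiding_residue[of "J (Suc n)" "Suc n" p] fin few unfolding good_def J_def by blast
  next
    case False
    then show ?thesis by (auto simp: good_def intro!: exI[of _ "int (Suc n) * p"])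
  qed
  then obtain b where b: "\<And>n. good (Suc n) (b n) (b (Suc n))"
    using dependent_nat_choice[of "\<lambda>_ _. True" "\<lambda>n p b. good (Suc n) p b"] by auto
  have "\<exists>a::real. \<forall>n. b n \<le> fact n * a \<and> fact n * a \<le> b n + 1"
    by (rule ex_real_with_factorial_truncations) (use b in \<open>auto simp: good_def\<close>)
  then obtain a :: real where a: "\<And>n. b n \<le> fact n * a" "\<And>n. fact n * a \<le> b n + 1" by auto
  have "x \<in> (\<Union>q\<in>\<rat>. translate C0 (a + q))" if "x \<in> K" for x
  proof -
    have dig: "\<lfloor>fact n * (x - a)\<rfloor> mod int n \<noteq> int n - 1" if "n > N" for n
    proof
      assume max: "\<lfloor>fact n * (x - a)\<rfloor> mod int n = int n - 1"
      define j where "j = \<lfloor>fact n * x\<rfloor>"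
      have "j \<in> J n" using \<open>x \<in> K\<close> by (auto simp: J_def j_def)
      then have avoid: "(j - b n) mod int n \<noteq> 0" "(j + 1 - b n) mod int n \<noteq> 0"
        using b[of "n - 1"] that by (auto simp: good_def)
      \<comment> \<open>The second alternative is a borrow from the places beyond \<open>n\<close>.\<close>
      have "j \<le> fact n * x" "fact n * x < j + 1" by (auto simp: j_def)
      then have "\<lfloor>fact n * (x - a)\<rfloor> = j - b n \<or> \<lfloor>fact n * (x - a)\<rfloor> = j - b n - 1"
        using a[of n] by (simp add: algebra_simps) linarith
      moreover have "(\<lfloor>fact n * (x - a)\<rfloor> + 1) mod int n = 0"
      proof -
        have "(\<lfloor>fact n * (x - a)\<rfloor> + 1) mod int n = ((int n - 1) + 1) mod int n"
          using max by (metis mod_add_left_eq)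
        then show ?thesis by simp
      qed
      ultimately show False using avoid by (auto simp: algebra_simps)
    qed
    define q where "q = \<lfloor>fact N * (x - a)\<rfloor> / (fact N :: real)"
    have "q \<in> \<rat>" unfolding q_def by (metis Rats_divide Rats_of_int of_int_fact)
    moreover have "x - a - q \<in> C0"
      unfolding q_def by (rule diff_truncation_in_C0[OF \<open>N \<ge> 1\<close> dig])
    then have "x \<in> translate C0 (a + q)"
      unfolding translate_def by (auto intro!: exI[of _ "x - a - q"])
    ultimately show ?thesis by blast
  qed
  then show ?thesis by blast
qed

section \<open>Cantor sets\<close>

lemma compact_space_cantor: "compact_space (euclidean :: cantor topology)"
proof -
  have "compact_space (euclidean :: bool topology)"
    by (simp add: compact_space_def finite_imp_compact)
  then show ?thesis
    by (simp add: compact_space_product_topology flip: euclidean_product_topology)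
qed

text \<open>By compactness, a continuous injection of the Cantor space into a Hausdorff space is an embedding.
  Perfect sets can therefore be produced just by composing injections.\<close>

lemma Perf_iff_injective_image:
  assumes "Hausdorff_space X"
  shows "P \<in> Perf X \<longleftrightarrow>
    (\<exists>h :: cantor \<Rightarrow> _. continuous_map euclidean X h \<and> inj h \<and> P = range h)"
proof
  assume P: "P \<in> Perf X"
  then have "(euclidean :: cantor topology) homeomorphic_space subtopology X P"
    unfolding Perf_def by (simp add: homeomorphic_space_sym[of euclidean])
  then obtain h :: "cantor \<Rightarrow> _" where h: "homeomorphic_map euclidean (subtopology X P) h"
    by (auto simp: homeomorphic_space)
  have "topspace (subtopology X P) = P" using P by (auto simp: Perf_def)
  then have "continuous_map euclidean X h" "inj h" "P = range h"
    using h homeomorphic_imp_continuous_map[OF h] homeomorphic_imp_surjective_map[OF h]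
      homeomorphic_imp_injective_map[OF h]
    by (auto simp: continuous_map_in_subtopology)
  then show "\<exists>h :: cantor \<Rightarrow> _. continuous_map euclidean X h \<and> inj h \<and> P = range h" by blast
next
  assume "\<exists>h :: cantor \<Rightarrow> _. continuous_map euclidean X h \<and> inj h \<and> P = range h"
  then obtain h :: "cantor \<Rightarrow> _" where h: "continuous_map euclidean X h" "inj h" "P = range h"
    by blast
  then have "embedding_map euclidean X h"
    by (intro continuous_imp_embedding_map compact_space_cantor assms) auto
  then have "(euclidean :: cantor topology) homeomorphic_space subtopology X P"
    using h by (auto simp: embedding_map_def homeomorphic_space)
  moreover have "P \<subseteq> topspace X"
    using h continuous_map_image_subset_topspace by fastforce
  ultimately show "P \<in> Perf X"
    unfolding Perf_def by (simp add: homeomorphic_space_sym[of euclidean])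
qed

lemma Hausdorff_space_cantor: "Hausdorff_space (euclidean :: cantor topology)"
proof -
  have "Hausdorff_space (euclidean :: bool topology)"
    unfolding Hausdorff_space_def disjnt_def open_openin[symmetric] by (metis hausdorff)
  then show ?thesis
    by (simp add: Hausdorff_space_product_topology flip: euclidean_product_topology)
qed

lemma Perf_cantor_iff:
  "P \<in> Perf (euclidean :: cantor topology) \<longleftrightarrow>
    (\<exists>h :: cantor \<Rightarrow> cantor. continuous_on UNIV h \<and> inj h \<and> P = range h)"
  using Perf_iff_injective_image[OF Hausdorff_space_cantor] by simp

lemma Perf_real_iff:
  "P \<in> Perf (euclidean :: real topology) \<longleftrightarrow>
    (\<exists>h :: cantor \<Rightarrow> real. continuous_on UNIV h \<and> inj h \<and> P = range h)"
  using Perf_iff_injective_image[OF Hausdorff_space_euclidean] by simp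

lemma open_cylinder: "open {w' :: cantor. \<forall>s<m. w' s = w s}"
proof -
  have "open ((\<lambda>w' :: cantor. w' s) -` {w s})" for s
    by (intro open_vimage open_discrete continuous_on_product_coordinates)
  then have "open (\<Inter>s\<in>{..<m}. (\<lambda>w' :: cantor. w' s) -` {w s})" by (intro open_INT) auto
  also have "(\<Inter>s\<in>{..<m}. (\<lambda>w' :: cantor. w' s) -` {w s}) = {w'. \<forall>s<m. w' s = w s}" by auto
  finally show ?thesis .
qed

lemma ex_cylinder_subset:
  fixes w :: cantor
  assumes "open V" "w \<in> V"
  shows "\<exists>m. {w'. \<forall>s<m. w' s = w s} \<subseteq> V"
proof -
  have "openin (product_topology (\<lambda>_. euclidean) UNIV) V"
    using assms(1) by (simp add: euclidean_product_topology)
  then obtain X where X: "w \<in> Pi\<^sub>E UNIV X" "finite {i. X i \<noteq> UNIV}" "Pi\<^sub>E UNIV X \<subseteq> V"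
    using product_topology_open_contains_basis[of "\<lambda>_. euclidean" UNIV V w] assms(2) by auto
  obtain m where m: "\<And>i. X i \<noteq> UNIV \<Longrightarrow> i < m"
    using finite_nat_set_iff_bounded[of "{i. X i \<noteq> UNIV}"] X(2) by auto
  have "{w'. \<forall>s<m. w' s = w s} \<subseteq> Pi\<^sub>E UNIV X"
  proof (intro subsetI PiE_I)
    fix w' i assume w': "w' \<in> {w'. \<forall>s<m. w' s = w s}"
    have "w i \<in> X i" using X(1) by (rule PiE_mem) simp
    show "w' i \<in> X i"
    proof (cases "X i = UNIV")
      case False
      then have "w' i = w i" using m w' by blast
      then show ?thesis using \<open>w i \<in> X i\<close> by simp
    qed simp
  qed simp
  then show ?thesis using X(3) by (metis subset_trans)
qed

text \<open>Uniform continuity on the Cantor space, stated through initial segments in place of a metric.\<close>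

lemma continuous_cantor_finite_dependence:
  fixes G :: "cantor \<Rightarrow> real"
  assumes "continuous_on UNIV G" "\<epsilon> > 0"
  shows "\<exists>m. \<forall>w w'. (\<forall>s<m. w s = w' s) \<longrightarrow> \<bar>G w - G w'\<bar> < \<epsilon>"
proof -
  have "\<exists>k. {w'. \<forall>s<k. w' s = w s} \<subseteq> G -` ball (G w) (\<epsilon> / 2)" for w
    by (rule ex_cylinder_subset[OF open_vimage[OF open_ball assms(1)]]) (use assms(2) in simp)
  then obtain k where k: "\<And>w. {w'. \<forall>s<k w. w' s = w s} \<subseteq> G -` ball (G w) (\<epsilon> / 2)" by metis
  have "compact (UNIV :: cantor set)"
    using compact_space_cantor by (simp add: compact_space_def)
  then obtain C where C: "finite C" "UNIV \<subseteq> (\<Union>w\<in>C. {w'. \<forall>s<k w. w' s = w s})"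
    by (rule compactE_image[where C = UNIV and f = "\<lambda>w. {w'. \<forall>s<k w. w' s = w s}"])
      (use open_cylinder in auto)
  obtain m where m: "\<And>w. w \<in> C \<Longrightarrow> k w \<le> m"
    using C(1) by (metis finite_imageI finite_nat_set_iff_bounded_le imageI)
  have "\<bar>G w - G w'\<bar> < \<epsilon>" if agree: "\<forall>s<m. w s = w' s" for w w'
  proof -
    obtain c where c: "c \<in> C" "\<forall>s<k c. w s = c s" using C(2) by blast
    then have "\<forall>s<k c. w' s = c s" using agree m[OF c(1)] by (metis less_le_trans)
    then have "w' \<in> G -` ball (G c) (\<epsilon> / 2)" by (intro subsetD[OF k]) simp
    moreover have "w \<in> G -` ball (G c) (\<epsilon> / 2)" using c(2) by (intro subsetD[OF k]) simp
    ultimately have "\<bar>G c - G w'\<bar> < \<epsilon> / 2" "\<bar>G c - G w\<bar> < \<epsilon> / 2"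
      by (simp_all add: dist_real_def)
    then show ?thesis by linarith
  qed
  then show ?thesis by blast
qed

section \<open>Sparse subcubes\<close>

text \<open>\<open>spread e y\<close> writes the bits of \<open>y\<close> at the places \<open>e 0, e 1, \<dots>\<close> and zeros everywhere else. For
  injective \<open>e\<close> it embeds the Cantor space onto the sequences supported in the range of \<open>e\<close>.\<close>

definition spread :: "(nat \<Rightarrow> nat) \<Rightarrow> cantor \<Rightarrow> cantor" where
  "spread e y s \<longleftrightarrow> (\<exists>t. s = e t \<and> y t)"

lemma spread_at: "inj e \<Longrightarrow> spread e y (e t) = y t"
  unfolding spread_def inj_def by blast

lemma inj_spread: "inj e \<Longrightarrow> inj (spread e)"
proof (rule injI)
  fix y z assume "inj e" "spread e y = spread e z"
  then show "y = z" using spread_at[of e y] spread_at[of e z] by (intro ext) simp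
qed

lemma continuous_on_spread:
  assumes "inj e"
  shows "continuous_on UNIV (spread e)"
proof (rule continuous_on_coordinatewise_then_product)
  fix s
  show "continuous_on UNIV (\<lambda>y. spread e y s)"
  proof (cases "s \<in> range e")
    case True
    then obtain t where "s = e t" by blast
    then show ?thesis by (simp add: spread_at[OF assms])
  next
    case False
    then have "spread e y s = False" for y by (auto simp: spread_def)
    then show ?thesis by (simp only: continuous_on_const)
  qed
qed

text \<open>Up to an error below \<open>1\<close>, the number \<open>n! G (spread e y)\<close> depends only on the bits \<open>y t\<close> with
  \<open>e t < m\<close>, all of which satisfy \<open>2 ^ (t + 4) < n\<close>. If there are \<open>c\<close> such \<open>t\<close>, there are \<open>2 ^ c\<close>
  patterns for these bits, and each pattern allows three values of the floor. The bound follows from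
  \<open>6 * 2 ^ c < 2 ^ (c + 3) < n\<close> when \<open>c > 0\<close>; the case \<open>c = 0\<close> needs \<open>n > 6\<close>.\<close>

lemma few_floors_on_spread:
  fixes G :: "cantor \<Rightarrow> real"
  assumes "n > 6"
      and dep: "\<And>w w'. (\<forall>s<m. w s = w' s) \<Longrightarrow> \<bar>G w - G w'\<bar> < 1 / fact n"
      and sparse: "\<And>t. e t < m \<Longrightarrow> 2 ^ (t + 4) < n"
  shows "finite (range (\<lambda>y. \<lfloor>fact n * G (spread e y)\<rfloor>))"
    and "card (range (\<lambda>y. \<lfloor>fact n * G (spread e y)\<rfloor>)) * 2 < n"
proof -
  let ?fl = "\<lambda>y. \<lfloor>fact n * G (spread e y)\<rfloor>"
  define T where "T = {t. 2 ^ (t + 4) < n}"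
  have "T \<subseteq> {..<n}"
  proof
    fix t assume "t \<in> T"
    then have "t + 4 < n" unfolding T_def using less_trans[OF less_exp[of "t + 4"]] by blast
    then show "t \<in> {..<n}" by simp
  qed
  then have finT: "finite T" by (rule finite_subset) simp
  define B where "B A = {?fl (\<lambda>t. t \<in> A) - 1 .. ?fl (\<lambda>t. t \<in> A) + 1}" for A
  have sub: "range ?fl \<subseteq> (\<Union>A\<in>Pow T. B A)"
  proof (rule image_subsetI)
    fix y :: cantor
    define A where "A = {t \<in> T. y t}"
    have "\<forall>s<m. spread e y s = spread e (\<lambda>t. t \<in> A) s"
      using sparse by (auto simp: spread_def A_def T_def)
    then have "fact n * \<bar>G (spread e y) - G (spread e (\<lambda>t. t \<in> A))\<bar> < 1"
      using dep by (simp add: field_simps)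
    then have "\<bar>fact n * G (spread e y) - fact n * G (spread e (\<lambda>t. t \<in> A))\<bar> < 1"
      by (simp add: abs_mult flip: right_diff_distrib)
    then have "?fl y \<in> B A"
      unfolding B_def atLeastAtMost_iff by linarith
    then show "?fl y \<in> (\<Union>A\<in>Pow T. B A)" by (auto simp: A_def)
  qed
  have fin: "finite (\<Union>A\<in>Pow T. B A)" using finT by (auto simp: B_def)
  then show "finite (range ?fl)" using sub by (rule rev_finite_subset)
  have "card (range ?fl) \<le> card (\<Union>A\<in>Pow T. B A)" using sub fin by (rule card_mono[rotated])
  also have "\<dots> \<le> (\<Sum>A\<in>Pow T. card (B A))" using finT by (intro card_UN_le) simp
  also have "\<dots> = 3 * 2 ^ card T" using finT by (simp add: B_def card_Pow)
  finally have le: "card (range ?fl) * 2 \<le> 6 * 2 ^ card T" by simp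
  show "card (range ?fl) * 2 < n"
  proof (cases "T = {}")
    case True
    then show ?thesis using le \<open>n > 6\<close> by simp
  next
    case False
    define t where "t = Max T"
    have "t \<in> T" using finT False by (simp add: t_def)
    have "T \<subseteq> {..t}" using finT by (auto simp: t_def)
    then have "card T \<le> t + 1" using card_mono[of "{..t}" T] by simp
    then have "(2::nat) ^ card T \<le> 2 ^ (t + 1)" by (rule power_increasing) simp
    moreover have "(2::nat) ^ (t + 4) < n" using \<open>t \<in> T\<close> by (simp add: T_def)
    ultimately show ?thesis using le by (simp add: power_add)
  qed
qed

text \<open>The place \<open>e t\<close> only has to be at least \<open>L t\<close>. This freedom is used below to spread the bits over
  all coordinates of a cube.\<close>

lemma ex_sparse_spread:
  fixes G :: "cantor \<Rightarrow> real"
  assumes "continuous_on UNIV G"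
  shows "\<exists>L. strict_mono L \<and> (\<forall>e. (\<forall>t. L t \<le> e t) \<longrightarrow> (\<forall>n>6.
           finite (range (\<lambda>y. \<lfloor>fact n * G (spread e y)\<rfloor>)) \<and>
           card (range (\<lambda>y. \<lfloor>fact n * G (spread e y)\<rfloor>)) * 2 < n))"
proof -
  have "\<exists>m. \<forall>w w'. (\<forall>s<m. w s = w' s) \<longrightarrow> \<bar>G w - G w'\<bar> < 1 / fact n" for n
    by (rule continuous_cantor_finite_dependence[OF assms]) simp
  then obtain m where m: "\<And>n w w'. (\<forall>s<m n. w s = w' s) \<Longrightarrow> \<bar>G w - G w'\<bar> < 1 / fact n"
    by metis
  \<comment> \<open>The sum dominates every \<open>m n\<close> with \<open>n \<le> 2 ^ (t + 4)\<close>, so bit \<open>t\<close> matters only for larger \<open>n\<close>; the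
      summand \<open>t\<close> makes \<open>L\<close> strictly increasing.\<close>
  define L where "L t = t + (\<Sum>n\<le>2 ^ (t + 4). m n)" for t :: nat
  have "strict_mono L"
  proof (rule strict_monoI)
    fix t t' :: nat assume "t < t'"
    then have "(2::nat) ^ (t + 4) \<le> 2 ^ (t' + 4)" by (intro power_increasing) auto
    then have "(\<Sum>n\<le>2 ^ (t + 4). m n) \<le> (\<Sum>n\<le>2 ^ (t' + 4). m n)" by (intro sum_mono2) auto
    then show "L t < L t'" using \<open>t < t'\<close> by (simp add: L_def)
  qed
  have sparse: "2 ^ (t + 4) < n" if "L t \<le> e t" "e t < m n" for t n and e :: "nat \<Rightarrow> nat"
  proof (rule ccontr)
    assume "\<not> 2 ^ (t + 4) < n"
    then have "m n \<le> (\<Sum>n\<le>2 ^ (t + 4). m n)" by (intro member_le_sum) auto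
    then show False using that by (simp add: L_def)
  qed
  have "finite (range (\<lambda>y. \<lfloor>fact n * G (spread e y)\<rfloor>)) \<and>
      card (range (\<lambda>y. \<lfloor>fact n * G (spread e y)\<rfloor>)) * 2 < n" if "\<forall>t. L t \<le> e t" "n > 6" for e n
  proof -
    have "2 ^ (t + 4) < n" if "e t < m n" for t
      by (rule sparse[where e = e]) (use \<open>\<forall>t. L t \<le> e t\<close> that in simp_all)
    from few_floors_on_spread[where G = G and m = "m n" and e = e, OF \<open>n > 6\<close> m this]
    show ?thesis by simp
  qed
  with \<open>strict_mono L\<close> show ?thesis by (intro exI[of _ L]) simp
qed

text \<open>The cube \<open>D\<close> is the product of Cantor sets, so its points are coded by a single bit sequence \<open>w\<close>
  whose bit at \<open>prod_encode (k, i)\<close> is the \<open>i\<close>-th bit of the code of coordinate \<open>k\<close>. The free bits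
  of the subcube are dealt out by \<open>prod_decode\<close>: bit \<open>t\<close> goes to coordinate \<open>fst (prod_decode t)\<close>.
  Every coordinate thus gets infinitely many free bits, chosen independently of the other coordinates,
  which makes the image of \<open>spread\<close> a perfect cube again.\<close>

lemma ex_thin_subcube:
  fixes f :: "(nat \<Rightarrow> cantor) \<Rightarrow> real"
  assumes "perfect_cube D" "continuous_on D f" "inj_on f D"
  shows "\<exists>D'\<subseteq>D. perfect_cube D' \<and> f ` D' \<in> Perf euclidean \<and>
           (\<forall>n>6. finite ((\<lambda>x. \<lfloor>fact n * x\<rfloor>) ` f ` D') \<and>
                  card ((\<lambda>x. \<lfloor>fact n * x\<rfloor>) ` f ` D') * 2 < n)"
proof -
  obtain P where P: "\<And>k. P k \<in> Perf euclidean" and D: "D = {x. \<forall>k. x k \<in> P k}"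
    using assms(1) by (auto simp: perfect_cube_def)
  have "\<forall>k. \<exists>h :: cantor \<Rightarrow> cantor. continuous_on UNIV h \<and> inj h \<and> P k = range h"
    using P unfolding Perf_cantor_iff by (rule allI)
  then obtain h :: "nat \<Rightarrow> cantor \<Rightarrow> cantor"
    where h: "\<And>k. continuous_on UNIV (h k)" "\<And>k. inj (h k)" "\<And>k. P k = range (h k)"
    by metis
  define \<Psi> where "\<Psi> w k = h k (\<lambda>i. w (prod_encode (k, i)))" for w :: cantor and k
  have cont_\<Psi>: "continuous_on UNIV \<Psi>"
  proof (rule continuous_on_coordinatewise_then_product)
    fix k
    have "continuous_on UNIV (\<lambda>(w :: cantor) i. w (prod_encode (k, i)))"
      by (intro continuous_on_coordinatewise_then_product continuous_on_product_coordinates)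
    then show "continuous_on UNIV (\<lambda>w. \<Psi> w k)"
      unfolding \<Psi>_def by (rule continuous_on_compose2[OF h(1)]) simp
  qed
  have inj_\<Psi>: "inj \<Psi>"
  proof (rule injI)
    fix w w' assume "\<Psi> w = \<Psi> w'"
    then have "(\<lambda>i. w (prod_encode (k, i))) = (\<lambda>i. w' (prod_encode (k, i)))" for k
      using injD[OF h(2)] unfolding \<Psi>_def by metis
    then show "w = w'" by (metis ext prod_decode_inverse surj_pair)
  qed
  have range_\<Psi>: "range \<Psi> \<subseteq> D" by (auto simp: D \<Psi>_def h(3))
  have "continuous_on UNIV (f \<circ> \<Psi>)"
    using continuous_on_compose[OF cont_\<Psi>] continuous_on_subset[OF assms(2) range_\<Psi>] by blast
  then obtain L where L: "strict_mono L"
    and thin: "\<And>e n. (\<forall>t. L t \<le> e t) \<Longrightarrow> n > 6 \<Longrightarrow>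
      finite (range (\<lambda>y. \<lfloor>fact n * (f \<circ> \<Psi>) (spread e y)\<rfloor>)) \<and>
      card (range (\<lambda>y. \<lfloor>fact n * (f \<circ> \<Psi>) (spread e y)\<rfloor>)) * 2 < n"
    using ex_sparse_spread by blast
  \<comment> \<open>Bit \<open>t\<close> is written at place \<open>L t\<close> of its coordinate; the code of that pair is at least \<open>L t\<close>.\<close>
  define e where "e t = prod_encode (fst (prod_decode t), L t)" for t
  have "inj e"
    using strict_mono_eq[OF L] by (auto simp: inj_def e_def)
  define H where "H y = \<Psi> (spread e y)" for y
  have "inj H" unfolding H_def using inj_\<Psi> inj_spread[OF \<open>inj e\<close>] by (auto simp: inj_def)
  have cont_H: "continuous_on UNIV H"
    unfolding H_def
    by (rule continuous_on_compose2[OF cont_\<Psi> continuous_on_spread[OF \<open>inj e\<close>]]) simp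
  have range_H: "range H \<subseteq> D" using range_\<Psi> by (auto simp: H_def)
  \<comment> \<open>The part of \<open>e\<close> that concerns coordinate \<open>k\<close>, along which the subcube factors.\<close>
  define e' where "e' k j = L (prod_encode (k, j))" for k j
  have "inj (e' k)" for k
    using strict_mono_eq[OF L] by (auto simp: inj_def e'_def)
  have row: "(\<lambda>i. spread e y (prod_encode (k, i))) = spread (e' k) (\<lambda>j. y (prod_encode (k, j)))"
    for y k
  proof
    fix i
    show "spread e y (prod_encode (k, i)) = spread (e' k) (\<lambda>j. y (prod_encode (k, j))) i"
      unfolding spread_def e_def e'_def
      by (metis fst_conv prod.collapse prod_decode_inverse prod_encode_eq prod_encode_inverse snd_conv)
  qed
  have H_eq: "H y k = h k (spread (e' k) (\<lambda>j. y (prod_encode (k, j))))" for y k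
    by (simp add: H_def \<Psi>_def row)
  define P' where "P' k = range (h k \<circ> spread (e' k))" for k
  have "P' k \<in> Perf euclidean" for k
  proof -
    have "continuous_on UNIV (h k \<circ> spread (e' k))"
      by (rule continuous_on_compose[OF continuous_on_spread[OF \<open>inj (e' k)\<close>]])
        (rule continuous_on_subset[OF h(1)], simp)
    moreover have "inj (h k \<circ> spread (e' k))"
      by (rule inj_compose[OF h(2) inj_spread[OF \<open>inj (e' k)\<close>]])
    ultimately show ?thesis unfolding Perf_cantor_iff P'_def by blast
  qed
  moreover have "range H = {x. \<forall>k. x k \<in> P' k}"
  proof
    show "range H \<subseteq> {x. \<forall>k. x k \<in> P' k}" by (auto simp: P'_def H_eq)
    show "{x. \<forall>k. x k \<in> P' k} \<subseteq> range H"
    proof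
      fix x assume "x \<in> {x. \<forall>k. x k \<in> P' k}"
      then have "\<forall>k. \<exists>z. x k = h k (spread (e' k) z)" by (auto simp: P'_def)
      then obtain z where z: "\<And>k. x k = h k (spread (e' k) (z k))" by metis
      have "x = H (\<lambda>t. case prod_decode t of (k, j) \<Rightarrow> z k j)"
        by (rule ext) (simp add: H_eq z)
      then show "x \<in> range H" by blast
    qed
  qed
  ultimately have "perfect_cube (range H)" unfolding perfect_cube_def by blast
  moreover have "f ` range H \<in> Perf euclidean"
  proof -
    have "continuous_on UNIV (f \<circ> H)"
      using continuous_on_compose[OF cont_H] continuous_on_subset[OF assms(2) range_H] by blast
    moreover have "inj (f \<circ> H)"
      using \<open>inj H\<close> inj_on_subset[OF assms(3) range_H] by (rule comp_inj_on)
    ultimately show ?thesis unfolding Perf_real_iff by (metis image_comp)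
  qed
  moreover have "\<forall>t. L t \<le> e t" by (simp add: e_def le_prod_encode_2)
  then have "\<forall>n>6. finite ((\<lambda>x. \<lfloor>fact n * x\<rfloor>) ` f ` range H) \<and>
      card ((\<lambda>x. \<lfloor>fact n * x\<rfloor>) ` f ` range H) * 2 < n"
    using thin by (simp add: image_image H_def)
  ultimately show ?thesis using range_H by blast
qed

section \<open>Covering the line\<close>

theorem theorem0p3:
  assumes "CPA_cube"
  shows "\<exists>A :: real set. |A| <o continuum \<and> (\<Union>a\<in>A. translate C0 a) = UNIV"
proof -
  define E :: "real set set"
    where "E = {K \<in> Perf euclidean. \<exists>a. K \<subseteq> (\<Union>q\<in>\<rat>. translate C0 (a + q))}"
  have "F_cube_dense euclidean E"
    unfolding F_cube_dense_def
  proof (intro conjI ballI; clarify?)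
    show "K \<in> Perf euclidean" if "K \<in> E" for K using that by (simp add: E_def)
    fix D and f :: "(nat \<Rightarrow> cantor) \<Rightarrow> real"
    assume "(D, f) \<in> F_cube euclidean"
    then have Df: "perfect_cube D" "continuous_on D f" "inj_on f D" by (auto simp: F_cube_def)
    obtain D' where D': "D' \<subseteq> D" "perfect_cube D'" "f ` D' \<in> Perf euclidean"
      and thin: "\<And>n. n > 6 \<Longrightarrow> finite ((\<lambda>x. \<lfloor>fact n * x\<rfloor>) ` f ` D')"
        "\<And>n. n > 6 \<Longrightarrow> card ((\<lambda>x. \<lfloor>fact n * x\<rfloor>) ` f ` D') * 2 < n"
      using ex_thin_subcube[OF Df] by blast
    have "f ` D' \<in> E"
      using D'(3) thin_set_covered_by_rational_translates[where N = 6, OF _ thin]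
      by (simp add: E_def)
    moreover have "(D', f) \<in> F_cube euclidean"
      using D' Df by (auto simp: F_cube_def intro: continuous_on_subset inj_on_subset)
    ultimately show "\<exists>D'\<subseteq>D. (D', f) \<in> F_cube euclidean \<and> f ` D' \<in> E" using D'(1) by blast
  qed
  moreover have "Polish (euclidean :: real topology)"
    unfolding Polish_def separable_space_def
    by (auto simp: completely_metrizable_space_euclidean Rats_closure_real
        intro!: exI[of _ \<rat>] countable_rat)
  ultimately have "\<exists>E0\<subseteq>E. |E0| \<le>o omega1 \<and> |topspace (euclidean :: real topology) - \<Union>E0| \<le>o omega1"
    using assms unfolding CPA_cube_def by blast
  then obtain E0 where E0: "E0 \<subseteq> E" "|E0| \<le>o omega1" "|- \<Union>E0| \<le>o omega1"
    by (auto simp: Compl_eq_Diff_UNIV)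
  have "\<forall>K\<in>E0. \<exists>a. K \<subseteq> (\<Union>q\<in>\<rat>. translate C0 (a + q))" using E0(1) by (auto simp: E_def)
  then obtain a where a: "\<And>K. K \<in> E0 \<Longrightarrow> K \<subseteq> (\<Union>q\<in>\<rat>. translate C0 (a K + q))" by metis
  \<comment> \<open>A point outside \<open>\<Union>E0\<close> lies in its own translate, as \<open>0 \<in> C0\<close>.\<close>
  define A where "A = (\<Union>K\<in>E0. (\<lambda>q. a K + q) ` \<rat>) \<union> - \<Union>E0"
  have c: "continuum =o omega2" using assms by (simp add: CPA_cube_def)
  have om: "Cinfinite omega1" by (rule Cinfinite_cardSuc[OF natLeq_Cinfinite])
  then have inf: "\<not> finite (Field omega1)" and co: "Card_order omega1"
    by (auto simp: cinfinite_def)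
  have "|(\<lambda>q. a K + q) ` \<rat>| \<le>o omega1" for K
  proof -
    have "countable ((\<lambda>q. a K + q) ` \<rat>)" by (intro countable_image countable_rat)
    then have "|(\<lambda>q. a K + q) ` \<rat>| \<le>o |UNIV :: nat set|"
      unfolding countable_def card_of_ordLeq[symmetric] by blast
    then have "|(\<lambda>q. a K + q) ` \<rat>| \<le>o natLeq"
      using card_of_nat by (rule ordLeq_ordIso_trans)
    then show ?thesis
      using cardSuc_ordLeq[OF natLeq_Card_order] by (rule ordLeq_transitive)
  qed
  then have "|\<Union>K\<in>E0. (\<lambda>q. a K + q) ` \<rat>| \<le>o omega1"
    by (intro card_of_UNION_ordLeq_infinite_Field[OF inf co E0(2)]) blast
  then have "|A| \<le>o omega1"
    unfolding A_def by (rule card_of_Un_ordLeq_infinite_Field[OF inf _ E0(3) co])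
  then have "|A| <o continuum"
    using ordLess_ordIso_trans[OF cardSuc_greater[OF co] ordIso_symmetric[OF c]]
    by (rule ordLeq_ordLess_trans)
  moreover have "(\<Union>a\<in>A. translate C0 a) = UNIV"
  proof (rule UNIV_eq_I[symmetric])
    fix x
    show "x \<in> (\<Union>a\<in>A. translate C0 a)"
    proof (cases "x \<in> \<Union>E0")
      case True
      then obtain K where K: "K \<in> E0" "x \<in> K" by blast
      then obtain q where "q \<in> \<rat>" "x \<in> translate C0 (a K + q)" using a by blast
      then show ?thesis using K(1) unfolding A_def by blast
    next
      case False
      have "0 \<in> C0" unfolding C0_def by (auto intro!: exI[of _ "\<lambda>_. 0"])
      then have "x \<in> translate C0 x" by (force simp: translate_def)
      then show ?thesis using False by (auto simp: A_def)
    qed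
  qed
  ultimately show ?thesis by (intro exI[of _ A] conjI)
qed

end
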